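(* Let $b:\mathbb R^d\to\mathbb R^d$, $\sigma:\mathbb R^d\to\mathbb R^{d\times D}$ satisfy: (A1) there are $L_1,L_2>0$ with $\|\sigma(u_1)-\sigma(u_2)\|_{HS}\le L_1|u_1-u_2|$ and $\|\sigma(u)\|_{HS}\le L_2$ for all $u,u_1,u_2\in\mathbb R^d$; (A2) there are $c_1>\frac{15}{2}L_1^2$, $L_3>0$, $q\ge1$ with $\langle u_1-u_2,b(u_1)-b(u_2)\rangle\le -c_1|u_1-u_2|^2$ and $|b(u_1)-b(u_2)|\le L_3(1+|u_1|^{q-1}+|u_2|^{q-1})|u_1-u_2|$ for all $u_1,u_2$. Let $W$ be a $D$-dimensional standard Brownian motion, $\tau>0$, and $\bar X^x_n$ the backward Euler--Maruyama approximation $\bar X_{n+1}=\bar X_n+b(\bar X_{n+1})\tau+\sigma(\bar X_n)\Delta W_n$, $\Delta W_n=W((n+1)\tau)-W(n\tau)$, $\bar X_0=x\in\mathbb R^d$. Then for any $r\ge1$ there is $K(r)>0$ independent of $\tau$ and $x$ such that for all $\tau\le1$ and $x\in\mathbb R^d$, $$\sup_{n\ge0}\mathbf E|\bar X^x_n|^r\le K(r)(1+|x|^r).$$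
   Context: $|\cdot|$ is the Euclidean norm and $\|\cdot\|_{HS}$ the Hilbert--Schmidt norm. *)

theory Defs
  imports "HOL-Probability.Probability"
begin

definition hs_norm :: "real^'m^'n \<Rightarrow> real" where
  "hs_norm A = sqrt (\<Sum>i\<in>UNIV. \<Sum>j\<in>UNIV. (A $ i $ j)^2)"

text \<open>Real power with the convention that the exponent 0 gives 1 (also at base 0).\<close>
definition rpow :: "real \<Rightarrow> real \<Rightarrow> real" where
  "rpow x a = (if a = 0 then 1 else x powr a)"

definition std_brownian_motion :: "'a measure \<Rightarrow> (real \<Rightarrow> 'a \<Rightarrow> real^'m) \<Rightarrow> bool" where
  "std_brownian_motion M W \<longleftrightarrow>
     prob_space M \<and>
     (\<forall>t\<ge>0. W t \<in> borel_measurable M) \<and>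
     (\<forall>\<omega>\<in>space M. W 0 \<omega> = 0) \<and>
     (\<forall>\<omega>\<in>space M. continuous_on {0..} (\<lambda>t. W t \<omega>)) \<and>
     (\<forall>s t. 0 \<le> s \<and> s < t \<longrightarrow>
        distributed M lborel (\<lambda>\<omega>. W t \<omega> - W s \<omega>)
          (\<lambda>v. ennreal (\<Prod>j\<in>UNIV. normal_density 0 (sqrt (t - s)) (v $ j)))) \<and>
     (\<forall>(n::nat) (tt::nat \<Rightarrow> real). 0 \<le> tt 0 \<and> (\<forall>i<n. tt i < tt (Suc i)) \<longrightarrow>
        prob_space.indep_vars M (\<lambda>_. borel) (\<lambda>i \<omega>. W (tt (Suc i)) \<omega> - W (tt i) \<omega>) {..<n})"

end

theory Submission
  imports Defs
begin

text \<open>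
  Put $V = 1 + |X|^2$. Dissipativity of $b$ gives
  $(1 + c\tau) V_{n+1} \le 1 + |X_n + \sigma(X_n) \Delta W_n|^2 + \tau B$.
  After raising to the power $m$ and averaging over $\Delta W_n$ and $-\Delta W_n$, which have the same
  law, the term linear in $\Delta W_n$ cancels. All other terms are of order $\tau V_n^{m-1}$ because
  $\sigma$ is bounded, and $\tau K V_n^{m-1} \le \tau\frac{c}{2} V_n^m + \tau E$. Hence
  $(1 + c\tau) \mathbf{E} V_{n+1}^m \le (1 + \frac{c}{2}\tau) \mathbf{E} V_n^m + \tau E$, which preserves
  $\mathbf{E} V_n^m \le A$ for every $A \ge 2E/c$. For $r \le 2m$ the bound on $\mathbf{E}|X_n|^r$ follows from
  $t^r \le l^{r-2m} (1+t^2)^m + l^r$ with $l = 1 + |x|$.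
\<close>

section \<open>Matrix norms\<close>

lemma hs_norm_eq_norm: "hs_norm (A :: real^'m^'n) = norm A"
  by (simp add: hs_norm_def norm_vec_def L2_set_def sum_nonneg)

lemma norm_matrix_vector_mult_le:
  fixes A :: "real^'m^'n"
  shows "norm (A *v x) \<le> norm A * norm x"
proof -
  have "(norm (A *v x))\<^sup>2 = (\<Sum>i\<in>UNIV. (A $ i \<bullet> x)\<^sup>2)"
    by (simp add: matrix_mult_dot norm_vec_def L2_set_def sum_nonneg)
  also have "\<dots> \<le> (\<Sum>i\<in>UNIV. (norm (A $ i))\<^sup>2 * (norm x)\<^sup>2)"
  proof (rule sum_mono)
    fix i
    have "\<bar>A $ i \<bullet> x\<bar>\<^sup>2 \<le> (norm (A $ i) * norm x)\<^sup>2"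
      by (intro power_mono Cauchy_Schwarz_ineq2) auto
    then show "(A $ i \<bullet> x)\<^sup>2 \<le> (norm (A $ i))\<^sup>2 * (norm x)\<^sup>2"
      by (simp add: power_mult_distrib)
  qed
  also have "\<dots> = (norm A * norm x)\<^sup>2"
    by (simp add: sum_distrib_right[symmetric] power_mult_distrib norm_vec_def[of A] L2_set_def sum_nonneg)
  finally show ?thesis
    by (rule power2_le_imp_le) simp
qed

section \<open>Power inequalities for a symmetric perturbation\<close>

text \<open>A Taylor bound whose linear term is kept exactly, because it has to cancel later; only
  the quadratic remainder is estimated. The induction multiplies by 1 + y, which is nonnegative, and
  ends with m + m^2 <= (m + 1)^2.\<close>

lemma power_one_plus_le_quadratic:
  fixes y :: real
  assumes "- 1 \<le> y"
  shows "(1 + y) ^ m \<le> 1 + real m * y + (real m)\<^sup>2 * y\<^sup>2 * (1 + \<bar>y\<bar>) ^ m"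
proof (induction m)
  case (Suc m)
  define P where "P = (1 + \<bar>y\<bar>) ^ m"
  have P: "1 \<le> P" "0 \<le> P" by (auto simp: P_def)
  have PS: "1 \<le> (1 + \<bar>y\<bar>) * P" using P mult_mono[of 1 "1 + \<bar>y\<bar>" 1 P] by simp
  have "(1 + y) ^ Suc m \<le> (1 + y) * (1 + real m * y + (real m)\<^sup>2 * y\<^sup>2 * P)"
    using Suc assms by (simp add: P_def mult_left_mono)
  also have "\<dots> = 1 + real (Suc m) * y + real m * y\<^sup>2 * 1 + (real m)\<^sup>2 * y\<^sup>2 * ((1 + y) * P)"
    by (simp add: algebra_simps power2_eq_square)
  also have "\<dots> \<le> 1 + real (Suc m) * y + real m * y\<^sup>2 * ((1 + \<bar>y\<bar>) * P)
                 + (real m)\<^sup>2 * y\<^sup>2 * ((1 + \<bar>y\<bar>) * P)"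
    using P PS by (intro add_mono mult_left_mono mult_right_mono) auto
  also have "\<dots> = 1 + real (Suc m) * y + (real m + (real m)\<^sup>2) * (y\<^sup>2 * ((1 + \<bar>y\<bar>) * P))"
    by (simp add: algebra_simps)
  also have "\<dots> \<le> 1 + real (Suc m) * y + (real (Suc m))\<^sup>2 * (y\<^sup>2 * ((1 + \<bar>y\<bar>) * P))"
    using P by (intro add_left_mono mult_right_mono mult_nonneg_nonneg)
       (auto simp: power2_eq_square algebra_simps)
  finally show ?case by (simp add: P_def mult.assoc)
qed simp

text \<open>With V factored out, the relative perturbation is y = (\<alpha> + \<beta>) / V. Since
  \<alpha> is of order sqrt (\<tau> V H) and \<beta> of order \<tau> H, the product V y^2 is of
  order \<tau> H^2, so the remainder V^m y^2 is of order \<tau> V^(m-1). \<open>H\<close> stands for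
  the random size of the noise.\<close>

lemma power_perturbed_le:
  fixes V H \<tau> \<alpha> \<beta> :: real
  assumes V: "1 \<le> V" and H: "1 \<le> H" and \<tau>: "0 < \<tau>" "\<tau> \<le> 1"
    and \<alpha>: "\<alpha>\<^sup>2 \<le> 4 * V * (\<tau> * H)" and \<beta>: "0 \<le> \<beta>" "\<beta> \<le> \<tau> * H"
    and pos: "0 \<le> V + \<beta> + \<alpha>"
  shows "(V + \<beta> + \<alpha>) ^ Suc k \<le> V ^ Suc k + real (Suc k) * V ^ k * (\<alpha> + \<beta>)
           + \<tau> * (10 * (real (Suc k))\<^sup>2 * 5 ^ Suc k * H ^ (k + 3)) * V ^ k"
proof -
  define m where "m = Suc k"
  define y where "y = (\<alpha> + \<beta>) / V"
  have y1: "- 1 \<le> y" using V pos by (simp add: y_def field_simps)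
  have Vy: "V * (1 + y) = V + \<beta> + \<alpha>" using V by (simp add: y_def field_simps)
  have tH: "\<tau> * H \<le> H" "0 \<le> \<tau> * H" using \<tau> H by (simp_all add: mult_le_cancel_right1)
  \<comment> \<open>One factor \<tau> is given up, using \<tau> <= 1, so that \<alpha>^2 and
    \<beta>^2 are both bounded to first order in \<tau>.\<close>
  have "\<beta>\<^sup>2 \<le> (\<tau> * H)\<^sup>2" using \<beta> by (intro power_mono)
  also have "\<dots> \<le> \<tau> * H * H" using tH by (simp add: power2_eq_square mult_left_mono)
  finally have b2: "\<beta>\<^sup>2 \<le> \<tau> * H\<^sup>2" by (simp add: power2_eq_square mult.assoc)
  have HH: "H \<le> H\<^sup>2" using H by (simp add: power2_eq_square)
  have "(\<alpha> + \<beta>)\<^sup>2 \<le> 2 * \<alpha>\<^sup>2 + 2 * \<beta>\<^sup>2"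
    using zero_le_power2[of "\<alpha> - \<beta>"] by (simp add: power2_eq_square algebra_simps)
  also have "\<dots> \<le> 8 * V * (\<tau> * H) + 2 * (\<tau> * H\<^sup>2)" using \<alpha> b2 by simp
  also have "\<dots> \<le> 8 * V * (\<tau> * H\<^sup>2) + 2 * V * (\<tau> * H\<^sup>2)"
    using V \<tau> HH by (intro add_mono mult_mono mult_right_mono mult_left_mono) auto
  finally have ab: "(\<alpha> + \<beta>)\<^sup>2 \<le> 10 * V * (\<tau> * H\<^sup>2)" by simp
  have y2: "V * y\<^sup>2 \<le> 10 * \<tau> * H\<^sup>2"
  proof -
    have "V * y\<^sup>2 = (\<alpha> + \<beta>)\<^sup>2 / V"
      using V by (simp add: y_def power2_eq_square)
    also have "\<dots> \<le> 10 * V * (\<tau> * H\<^sup>2) / V"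
      using ab V by (intro divide_right_mono) auto
    finally show ?thesis using V by simp
  qed
  \<comment> \<open>The factor (1 + |y|)^m needs only a crude bound: |y| <= 4 H, and H >= 1 absorbs
    the 1. This contributes H^m, which with the H^2 of \<open>y2\<close> gives the exponent k +
    3.\<close>
  have "y\<^sup>2 \<le> V * y\<^sup>2" using V by (simp add: mult_le_cancel_right1)
  also have "\<dots> \<le> 10 * 1 * H\<^sup>2" using y2 by (rule order.trans) (use \<tau> in \<open>intro mult_right_mono, auto\<close>)
  also have "\<dots> \<le> (4 * H)\<^sup>2" by (simp add: power_mult_distrib)
  finally have "\<bar>y\<bar> \<le> \<bar>4 * H\<bar>" by (simp only: abs_le_square_iff)
  then have y5: "1 + \<bar>y\<bar> \<le> 5 * H" using H by simp
  have "(V + \<beta> + \<alpha>) ^ m = V ^ m * (1 + y) ^ m"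
    by (simp add: Vy[symmetric] power_mult_distrib)
  also have "\<dots> \<le> V ^ m * (1 + real m * y + (real m)\<^sup>2 * y\<^sup>2 * (1 + \<bar>y\<bar>) ^ m)"
    using V by (intro mult_left_mono power_one_plus_le_quadratic y1) auto
  also have "\<dots> = V ^ m + real m * V ^ k * (V * y) + V ^ k * (real m)\<^sup>2 * ((V * y\<^sup>2) * (1 + \<bar>y\<bar>) ^ m)"
    by (simp add: m_def algebra_simps)
  also have "\<dots> \<le> V ^ m + real m * V ^ k * (V * y) + V ^ k * (real m)\<^sup>2 * ((10 * \<tau> * H\<^sup>2) * (5 * H) ^ m)"
  proof -
    have "(V * y\<^sup>2) * (1 + \<bar>y\<bar>) ^ m \<le> (10 * \<tau> * H\<^sup>2) * (5 * H) ^ m"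
      by (rule mult_mono[OF y2 power_mono[OF y5]]) (use \<tau> in auto)
    then show ?thesis
      using V by (intro add_left_mono mult_left_mono) auto
  qed
  also have "V * y = \<alpha> + \<beta>" using V by (simp add: y_def)
  also have "(10 * \<tau> * H\<^sup>2) * (5 * H) ^ m = \<tau> * (10 * 5 ^ m * H ^ (k + 3))"
    by (simp add: m_def power_mult_distrib power_add power2_eq_square power3_eq_cube)
  finally show ?thesis by (simp add: m_def mult_ac)
qed

text \<open>Adding the previous bound for \<alpha> and for -\<alpha> removes the linear term in
  \<alpha>, the only one of order sqrt \<tau>. The linear term in \<beta> is already of order \<tau>
  and raises the constant from 10 to 11.\<close>

lemma symmetrized_power_le:
  fixes V H \<tau> \<alpha> \<beta> :: real
  assumes V: "1 \<le> V" and H: "1 \<le> H" and \<tau>: "0 < \<tau>" "\<tau> \<le> 1"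
    and \<alpha>: "\<alpha>\<^sup>2 \<le> 4 * V * (\<tau> * H)" and \<beta>: "0 \<le> \<beta>" "\<beta> \<le> \<tau> * H"
    and pos: "0 \<le> V + \<beta> + \<alpha>" "0 \<le> V + \<beta> - \<alpha>"
  shows "(V + \<beta> + \<alpha>) ^ Suc k + (V + \<beta> - \<alpha>) ^ Suc k
     \<le> 2 * (V ^ Suc k + \<tau> * (11 * (real (Suc k))\<^sup>2 * 5 ^ Suc k * H ^ (k + 3)) * V ^ k)"
proof -
  let ?m = "real (Suc k)"
  have "?m * V ^ k * \<beta> \<le> ?m\<^sup>2 * 5 ^ Suc k * V ^ k * (\<tau> * H ^ (k + 3))"
  proof (rule mult_mono)
    have "?m * 1 * V ^ k \<le> ?m\<^sup>2 * 5 ^ Suc k * V ^ k"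
      using V by (intro mult_right_mono mult_mono one_le_power) (auto simp: power2_eq_square)
    then show "?m * V ^ k \<le> ?m\<^sup>2 * 5 ^ Suc k * V ^ k" by simp
    have "H ^ 1 \<le> H ^ (k + 3)" using H by (intro power_increasing) auto
    then show "\<beta> \<le> \<tau> * H ^ (k + 3)" using \<beta> \<tau> by (intro order.trans[OF \<beta>(2)] mult_left_mono) auto
  qed (use V \<beta> in auto)
  note b = this
  define T where "T = ?m\<^sup>2 * 5 ^ Suc k * V ^ k * (\<tau> * H ^ (k + 3))"
  have p: "(V + \<beta> + \<alpha>) ^ Suc k \<le> V ^ Suc k + (?m * V ^ k * \<alpha> + ?m * V ^ k * \<beta>) + 10 * T"
    using power_perturbed_le[OF V H \<tau> \<alpha> \<beta> pos(1), of k]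
    unfolding T_def distrib_left by (simp only: mult_ac)
  have m: "(V + \<beta> - \<alpha>) ^ Suc k \<le> V ^ Suc k + (- (?m * V ^ k * \<alpha>) + ?m * V ^ k * \<beta>) + 10 * T"
  proof -
    have "(- \<alpha>)\<^sup>2 \<le> 4 * V * (\<tau> * H)" "0 \<le> V + \<beta> + - \<alpha>" using \<alpha> pos(2) by simp_all
    from power_perturbed_le[OF V H \<tau> this(1) \<beta> this(2), of k]
    have "(V + \<beta> - \<alpha>) ^ Suc k \<le> V ^ Suc k + ?m * V ^ k * (- \<alpha> + \<beta>) + 10 * T"
      unfolding T_def by (simp only: mult_ac diff_conv_add_uminus)
    then show ?thesis
      by (simp only: distrib_left mult_minus_right)
  qed
  have T: "\<tau> * (11 * ?m\<^sup>2 * 5 ^ Suc k * H ^ (k + 3)) * V ^ k = 11 * T"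
    unfolding T_def by (simp only: mult_ac)
  \<comment> \<open>The cancellation in abstract form: \<open>x\<close> is the term linear in
    \<alpha>, \<open>z\<close> the one linear in \<beta>.\<close>
  have *: "p + q \<le> 2 * (v + 11 * T)"
    if "p \<le> v + (x + z) + 10 * T" "q \<le> v + (- x + z) + 10 * T" "z \<le> T" for p q v x z :: real
    using add_mono[OF that(1,2)] that(3) by (simp add: algebra_simps)
  show ?thesis
    unfolding T by (rule *[OF p m b[folded T_def]])
qed

text \<open>Serves to dominate a function of the Euclidean norm by a product over coordinates, whose
  Gaussian integral factorises.\<close>

lemma one_plus_sum_le_prod:
  fixes f :: "'a \<Rightarrow> real"
  assumes "finite A" "\<And>x. x \<in> A \<Longrightarrow> 0 \<le> f x"
  shows "1 + sum f A \<le> (\<Prod>x\<in>A. 1 + f x)"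
  using assms
proof (induction A rule: finite_induct)
  case (insert a A)
  have "1 \<le> (\<Prod>x\<in>A. 1 + f x)" using insert by (intro prod_ge_1) auto
  then have "f a * 1 \<le> f a * (\<Prod>x\<in>A. 1 + f x)" using insert by (intro mult_left_mono) auto
  then show ?case using insert by (auto simp: algebra_simps)
qed simp

section \<open>Measurable solution of the implicit equation\<close>

text \<open>An expanding map is injective and its inverse is 1-Lipschitz on the range. The range is
  a countable union of compact images of balls, hence Borel, so the inverse may be extended by 0.
  Applied to u - \<tau> b(u), this makes the implicit scheme an explicit measurable
  recursion.\<close>

lemma measurable_left_inverse_expanding:
  fixes \<phi> :: "'a::euclidean_space \<Rightarrow> 'a"
  assumes cont: "continuous_on UNIV \<phi>" and exp: "\<And>u v. norm (u - v) \<le> norm (\<phi> u - \<phi> v)"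
  obtains g where "g \<in> borel_measurable borel" "\<And>u. g (\<phi> u) = u"
proof -
  have inj: "inj \<phi>"
  proof (rule injI)
    fix u v assume "\<phi> u = \<phi> v"
    with exp[of u v] show "u = v" by simp
  qed
  have "range \<phi> = (\<Union>n::nat. \<phi> ` cball 0 (real n))"
    by (auto simp: image_iff) (metis mem_cball_0 real_arch_simple)
  moreover have "\<phi> ` cball 0 (real n) \<in> sets borel" for n
    by (intro borel_compact compact_continuous_image continuous_on_subset[OF cont]) auto
  ultimately have "range \<phi> \<in> sets borel" by auto
  moreover have "continuous_on (range \<phi>) (inv \<phi>)"
    by (rule lipschitz_on_continuous_on[where L=1], rule lipschitz_onI)
       (use exp inj in \<open>auto simp: dist_norm\<close>)
  ultimately have "(\<lambda>y. if y \<in> range \<phi> then inv \<phi> y else 0) \<in> borel_measurable borel"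
    by (intro borel_measurable_continuous_on_if) auto
  then show ?thesis using inj by (intro that) auto
qed

section \<open>Gaussian increments: symmetry and scaled moments\<close>

text \<open>For \<tau> > 0 this is the centred normal law with covariance \<tau> times the identity;
  \<open>normal_density\<close> takes a standard deviation, whence the square root.\<close>

definition gaussian_measure :: "real \<Rightarrow> (real^'n) measure" where
  "gaussian_measure \<tau> = density lborel (\<lambda>v. ennreal (\<Prod>j\<in>UNIV. normal_density 0 (sqrt \<tau>) (v $ j)))"

lemma space_gaussian_measure [simp]: "space (gaussian_measure \<tau>) = UNIV"
  and sets_gaussian_measure [measurable_cong, simp]: "sets (gaussian_measure \<tau>) = sets borel"
  by (simp_all add: gaussian_measure_def)

lemma nn_integral_gaussian_measure:
  fixes f :: "real^'n \<Rightarrow> ennreal"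
  assumes [measurable]: "f \<in> borel_measurable borel"
  shows "(\<integral>\<^sup>+v. f v \<partial>gaussian_measure \<tau>)
           = (\<integral>\<^sup>+v. ennreal (\<Prod>j\<in>UNIV. normal_density 0 (sqrt \<tau>) (v $ j)) * f v \<partial>lborel)"
  unfolding gaussian_measure_def by (subst nn_integral_density) auto

lemma nn_integral_lborel_uminus:
  fixes f :: "'a::euclidean_space \<Rightarrow> ennreal"
  assumes [measurable]: "f \<in> borel_measurable borel"
  shows "(\<integral>\<^sup>+v. f (- v) \<partial>lborel) = (\<integral>\<^sup>+v. f v \<partial>lborel)"
  by (subst (2) lborel_affine[of "-1" 0])
     (auto simp: nn_integral_density nn_integral_distr)

text \<open>The density is even and Lebesgue measure is invariant under reflection.\<close>

lemma nn_integral_gaussian_measure_uminus: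
  fixes f :: "real^'n \<Rightarrow> ennreal"
  assumes [measurable]: "f \<in> borel_measurable borel"
  shows "(\<integral>\<^sup>+v. f (- v) \<partial>gaussian_measure \<tau>) = (\<integral>\<^sup>+v. f v \<partial>gaussian_measure \<tau>)"
proof -
  let ?p = "\<lambda>v::real^'n. ennreal (\<Prod>j\<in>UNIV. normal_density 0 (sqrt \<tau>) (v $ j))"
  have "?p (- v) = ?p v" for v
    by (simp add: normal_density_def)
  then have "(\<integral>\<^sup>+v. ?p v * f (- v) \<partial>lborel) = (\<integral>\<^sup>+v. ?p (- v) * f (- v) \<partial>lborel)"
    by simp
  also have "\<dots> = (\<integral>\<^sup>+v. ?p v * f v \<partial>lborel)"
    by (rule nn_integral_lborel_uminus) measurable
  finally show ?thesis by (simp add: nn_integral_gaussian_measure)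
qed

text \<open>Tonelli over the standard basis, reindexed by coordinates.\<close>

lemma nn_integral_lborel_prod_vec:
  fixes f :: "real \<Rightarrow> ennreal"
  assumes [measurable]: "f \<in> borel_measurable borel"
  shows "(\<integral>\<^sup>+v. (\<Prod>j\<in>UNIV. f (v $ j)) \<partial>(lborel :: (real^'n) measure)) = (\<integral>\<^sup>+x. f x \<partial>lborel) ^ CARD('n)"
proof -
  have B: "Basis = range (\<lambda>i::'n. axis i (1::real))" and inj: "inj (\<lambda>i::'n. axis i (1::real))"
    by (auto simp: Basis_vec_def inj_on_def axis_eq_axis)
  have "(\<integral>\<^sup>+v. (\<Prod>b\<in>Basis. f (v \<bullet> b)) \<partial>(lborel :: (real^'n) measure)) = (\<Prod>b\<in>(Basis::(real^'n) set). \<integral>\<^sup>+x. f x \<partial>lborel)"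
    by (rule nn_integral_lborel_prod) auto
  then show ?thesis
    by (simp add: B prod.reindex[OF inj] cart_eq_inner_axis card_image[OF inj])
qed

lemma integrable_std_normal_one_plus_square_power:
  "integrable lborel (\<lambda>z. std_normal_density z * (1 + z\<^sup>2) ^ N)"
proof -
  have "(1 + z\<^sup>2) ^ N = (\<Sum>k\<le>N. real (N choose k) * z ^ (2 * k))" for z :: real
    using binomial_ring[of "z\<^sup>2" 1 N] by (simp add: add.commute power_mult)
  then have "(\<lambda>z::real. std_normal_density z * (1 + z\<^sup>2) ^ N)
      = (\<lambda>z. \<Sum>k\<le>N. real (N choose k) * (std_normal_density z * z ^ (2 * k)))"
    by (simp add: fun_eq_iff sum_distrib_left mult_ac)
  then show ?thesis
    using integrable_std_normal_moment by simp
qed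

text \<open>Substitution x = s z. The value is free of s, which is the source of the uniformity in
  \<tau>.\<close>

lemma nn_integral_normal_one_plus_square_power:
  assumes s: "0 < s"
  shows "(\<integral>\<^sup>+x. ennreal (normal_density 0 s x * (1 + x\<^sup>2 / s\<^sup>2) ^ N) \<partial>lborel)
       = ennreal (\<integral>z. std_normal_density z * (1 + z\<^sup>2) ^ N \<partial>lborel)"
proof -
  have "(\<integral>\<^sup>+x. ennreal (normal_density 0 s x * (1 + x\<^sup>2 / s\<^sup>2) ^ N) \<partial>lborel)
      = \<bar>s\<bar> * (\<integral>\<^sup>+z. ennreal (normal_density 0 s (0 + s * z) * (1 + (0 + s * z)\<^sup>2 / s\<^sup>2) ^ N) \<partial>lborel)"
    using s by (intro nn_integral_real_affine) auto
  also have "\<dots> = (\<integral>\<^sup>+z. ennreal \<bar>s\<bar> * ennreal (normal_density 0 s (0 + s * z) * (1 + (0 + s * z)\<^sup>2 / s\<^sup>2) ^ N) \<partial>lborel)"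
    by (rule nn_integral_cmult[symmetric]) measurable
  also have "\<dots> = (\<integral>\<^sup>+z. ennreal (std_normal_density z * (1 + z\<^sup>2) ^ N) \<partial>lborel)"
  proof (rule nn_integral_cong)
    fix z
    have "s * normal_density 0 s (s * z) = std_normal_density z"
      using s by (simp add: normal_density_def real_sqrt_mult power_mult_distrib field_simps)
    then show "ennreal \<bar>s\<bar> * ennreal (normal_density 0 s (0 + s * z) * (1 + (0 + s * z)\<^sup>2 / s\<^sup>2) ^ N)
        = ennreal (std_normal_density z * (1 + z\<^sup>2) ^ N)"
      using s by (simp add: ennreal_mult'[symmetric] power_mult_distrib mult.assoc[symmetric])
  qed
  also have "\<dots> = ennreal (\<integral>z. std_normal_density z * (1 + z\<^sup>2) ^ N \<partial>lborel)"
    by (rule nn_integral_eq_integral[OF integrable_std_normal_one_plus_square_power]) auto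
  finally show ?thesis .
qed

text \<open>Bounding 1 + |v|^2 / \<tau> by the product of the 1 + v_j^2 / \<tau> splits the integral
  into one-dimensional ones, each independent of \<tau>.\<close>

lemma gaussian_measure_one_plus_norm_power_le:
  assumes \<tau>: "0 < \<tau>"
  shows "(\<integral>\<^sup>+v. ennreal ((1 + (norm v)\<^sup>2 / \<tau>) ^ N) \<partial>(gaussian_measure \<tau> :: (real^'n) measure))
       \<le> ennreal ((\<integral>z. std_normal_density z * (1 + z\<^sup>2) ^ N \<partial>lborel) ^ CARD('n))"
proof -
  let ?s = "sqrt \<tau>"
  let ?f = "\<lambda>x. ennreal (normal_density 0 ?s x * (1 + x\<^sup>2 / ?s\<^sup>2) ^ N)"
  have "(\<integral>\<^sup>+v. ennreal ((1 + (norm v)\<^sup>2 / \<tau>) ^ N) \<partial>(gaussian_measure \<tau> :: (real^'n) measure))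
      = (\<integral>\<^sup>+v. ennreal (\<Prod>j\<in>UNIV. normal_density 0 ?s (v $ j)) * ennreal ((1 + (norm v)\<^sup>2 / \<tau>) ^ N)
            \<partial>(lborel :: (real^'n) measure))"
    by (rule nn_integral_gaussian_measure) measurable
  also have "\<dots> \<le> (\<integral>\<^sup>+v. (\<Prod>j\<in>UNIV. ?f (v $ j)) \<partial>(lborel :: (real^'n) measure))"
  proof (rule nn_integral_mono)
    fix v :: "real^'n"
    have "(norm v)\<^sup>2 / \<tau> = (\<Sum>j\<in>UNIV. (v $ j)\<^sup>2 / \<tau>)"
      by (simp add: norm_vec_def L2_set_def sum_nonneg sum_divide_distrib)
    then have "1 + (norm v)\<^sup>2 / \<tau> \<le> (\<Prod>j\<in>UNIV. 1 + (v $ j)\<^sup>2 / \<tau>)"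
      using \<tau> by (simp add: one_plus_sum_le_prod)
    then have "(1 + (norm v)\<^sup>2 / \<tau>) ^ N \<le> (\<Prod>j\<in>UNIV. (1 + (v $ j)\<^sup>2 / \<tau>) ^ N)"
      unfolding prod_power_distrib[symmetric] using \<tau> by (intro power_mono) auto
    then have "(\<Prod>j\<in>UNIV. normal_density 0 ?s (v $ j)) * (1 + (norm v)\<^sup>2 / \<tau>) ^ N
       \<le> (\<Prod>j\<in>UNIV. normal_density 0 ?s (v $ j)) * (\<Prod>j\<in>UNIV. (1 + (v $ j)\<^sup>2 / \<tau>) ^ N)"
      by (intro mult_left_mono prod_nonneg) auto
    then show "ennreal (\<Prod>j\<in>UNIV. normal_density 0 ?s (v $ j)) * ennreal ((1 + (norm v)\<^sup>2 / \<tau>) ^ N)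
       \<le> (\<Prod>j\<in>UNIV. ?f (v $ j))"
      using \<tau> by (simp add: prod_ennreal prod.distrib ennreal_mult'[symmetric] prod_nonneg ennreal_leI)
  qed
  also have "\<dots> = (\<integral>\<^sup>+x. ?f x \<partial>lborel) ^ CARD('n)"
    by (rule nn_integral_lborel_prod_vec) measurable
  also have "\<dots> = ennreal ((\<integral>z. std_normal_density z * (1 + z\<^sup>2) ^ N \<partial>lborel) ^ CARD('n))"
    using \<tau> by (subst nn_integral_normal_one_plus_square_power) (auto simp: ennreal_power)
  finally show ?thesis .
qed

text \<open>The case N = 0 of the moment bound.\<close>

lemma emeasure_gaussian_measure_UNIV_le:
  assumes \<tau>: "0 < \<tau>"
  shows "emeasure (gaussian_measure \<tau> :: (real^'n) measure) UNIV \<le> 1"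
  using gaussian_measure_one_plus_norm_power_le[OF \<tau>, of 0, where 'n='n]
  by (simp add: nn_integral_const)

section \<open>Moment growth in one explicit step\<close>

text \<open>The base of the power is V + \<beta> + \<alpha>, where \<alpha> = 2 <u, A \<xi>> is odd
  in \<xi> and \<beta> = |A \<xi>|^2 + \<tau> B is even. Averaging over \<xi> and -\<xi> leaves an
  error of order \<tau> V^k. \<open>K\<close> precedes \<tau>, u and A in the quantifiers, as the
  iteration requires.\<close>

lemma gaussian_step_moment_le:
  fixes L B :: real and k :: nat
  assumes B: "0 \<le> B"
  shows "\<exists>K\<ge>0. \<forall>\<tau> (u::real^'d) (A::real^'n^'d). 0 < \<tau> \<longrightarrow> \<tau> \<le> 1 \<longrightarrow> norm A \<le> L \<longrightarrow>
     (\<integral>\<^sup>+\<xi>. ennreal ((1 + (norm (u + A *v \<xi>))\<^sup>2 + \<tau> * B) ^ Suc k) \<partial>gaussian_measure \<tau>)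
       \<le> ennreal ((1 + (norm u)\<^sup>2) ^ Suc k + \<tau> * K * (1 + (norm u)\<^sup>2) ^ k)"
proof -
  \<comment> \<open>The exponent k + 3 is the power of H in the symmetrised bound.\<close>
  define I where "I = (\<integral>z. std_normal_density z * (1 + z\<^sup>2) ^ (k + 3) \<partial>lborel) ^ CARD('n)"
  \<comment> \<open>The summands L^2 and B control the two parts of \<beta>; the 1 ensures H >=
    1.\<close>
  define D where "D = 1 + L\<^sup>2 + B"
  define c where "c = 11 * (real (Suc k))\<^sup>2 * 5 ^ Suc k * D ^ (k + 3)"
  have D: "1 \<le> D" using B by (simp add: D_def)
  have c: "0 \<le> c" using D by (simp add: c_def)
  have I: "0 \<le> I" unfolding I_def by (intro zero_le_power integral_nonneg_AE) auto
  show ?thesis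
  proof (intro exI[of _ "c * I"] conjI allI impI)
    show "0 \<le> c * I" using c I by simp
    fix \<tau> :: real and u :: "real^'d" and A :: "real^'n^'d"
    assume \<tau>: "0 < \<tau>" "\<tau> \<le> 1" and A: "norm A \<le> L"
    define V where "V = 1 + (norm u)\<^sup>2"
    define h where "h \<xi> = ennreal ((1 + (norm (u + A *v \<xi>))\<^sup>2 + \<tau> * B) ^ Suc k)" for \<xi>
    have cont: "continuous_on UNIV (\<lambda>\<xi>. A *v \<xi>)"
      by (intro linear_continuous_on) (simp add: matrix_vector_mul_bounded_linear)
    have [measurable]: "(\<lambda>\<xi>. A *v \<xi>) \<in> borel_measurable borel"
      by (rule borel_measurable_continuous_onI[OF cont])
    have h[measurable]: "h \<in> borel_measurable borel" unfolding h_def by measurable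
    have V: "1 \<le> V" by (simp add: V_def)
    let ?Z = "\<lambda>\<xi>::real^'n. 1 + (norm \<xi>)\<^sup>2 / \<tau>"
    have pw: "h \<xi> + h (- \<xi>) \<le> 2 * (ennreal (V ^ Suc k) + ennreal (\<tau> * c * V ^ k) * ennreal (?Z \<xi> ^ (k + 3)))" for \<xi>
    proof -
      define w where "w = A *v \<xi>"
      define \<alpha> where "\<alpha> = 2 * (u \<bullet> w)"
      define \<beta> where "\<beta> = (norm w)\<^sup>2 + \<tau> * B"
      \<comment> \<open>Under the Gaussian law |\<xi>|^2 is of order \<tau>, so the moments of
        \<open>H\<close> are bounded uniformly in \<tau>.\<close>
      define H where "H = D * ?Z \<xi>"
      have Z: "1 \<le> ?Z \<xi>" using \<tau> by simp
      have H: "1 \<le> H" unfolding H_def using mult_mono[OF D Z] D by simp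
      have "norm w \<le> L * norm \<xi>" unfolding w_def
        by (rule order.trans[OF norm_matrix_vector_mult_le mult_right_mono[OF A]]) simp
      then have "(norm w)\<^sup>2 \<le> (L * norm \<xi>)\<^sup>2" by (intro power_mono) auto
      also have "\<dots> = \<tau> * (L\<^sup>2 * ((norm \<xi>)\<^sup>2 / \<tau>))" using \<tau> by (simp add: power_mult_distrib)
      also have "\<dots> \<le> \<tau> * (L\<^sup>2 * ?Z \<xi>)" using \<tau> by (intro mult_left_mono) auto
      finally have w: "(norm w)\<^sup>2 \<le> \<tau> * (L\<^sup>2 * ?Z \<xi>)" .
      have "B * 1 \<le> B * ?Z \<xi>" using B Z by (intro mult_left_mono) auto
      then have "\<tau> * B \<le> \<tau> * (B * ?Z \<xi>)" using \<tau> by simp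
      moreover have "\<tau> * ((L\<^sup>2 + B) * z) = \<tau> * (L\<^sup>2 * z) + \<tau> * (B * z)" for z
        by (simp add: algebra_simps)
      ultimately have "\<beta> \<le> \<tau> * ((L\<^sup>2 + B) * ?Z \<xi>)"
        using w by (simp only: \<beta>_def add_mono)
      also have "\<dots> \<le> \<tau> * H" unfolding H_def D_def using \<tau> Z by (intro mult_left_mono mult_right_mono) auto
      finally have \<beta>: "\<beta> \<le> \<tau> * H" .
      have \<beta>0: "0 \<le> \<beta>" using \<tau> B by (simp add: \<beta>_def)
      have wH: "(norm w)\<^sup>2 \<le> \<tau> * H" using \<beta> mult_nonneg_nonneg[of \<tau> B] \<tau> B unfolding \<beta>_def by linarith
      have "\<bar>u \<bullet> w\<bar>\<^sup>2 \<le> (norm u * norm w)\<^sup>2" by (intro power_mono Cauchy_Schwarz_ineq2) auto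
      then have "\<alpha>\<^sup>2 \<le> 4 * ((norm u)\<^sup>2 * (norm w)\<^sup>2)" by (simp add: \<alpha>_def power_mult_distrib)
      also have "\<dots> \<le> 4 * (V * (\<tau> * H))"
        using wH V by (intro mult_left_mono mult_mono) (auto simp: V_def)
      finally have \<alpha>: "\<alpha>\<^sup>2 \<le> 4 * V * (\<tau> * H)" by simp
      have p: "1 + (norm (u + w))\<^sup>2 + \<tau> * B = V + \<beta> + \<alpha>" and m: "1 + (norm (u - w))\<^sup>2 + \<tau> * B = V + \<beta> - \<alpha>"
        by (simp_all add: V_def \<alpha>_def \<beta>_def power2_norm_eq_inner inner_add_left inner_add_right inner_diff_left inner_diff_right inner_commute)
      have pos: "0 \<le> V + \<beta> + \<alpha>" "0 \<le> V + \<beta> - \<alpha>"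
        unfolding p[symmetric] m[symmetric] using \<tau> B by auto
      have mul: "A *v (- \<xi>) = - w"
        by (simp add: w_def matrix_vector_mult_def vec_eq_iff sum_negf)
      have "h \<xi> + h (- \<xi>) = ennreal ((V + \<beta> + \<alpha>) ^ Suc k + (V + \<beta> - \<alpha>) ^ Suc k)"
        using pos by (simp add: h_def mul w_def[symmetric] p m ennreal_plus[symmetric] del: ennreal_plus power_Suc)
      also have "\<dots> \<le> ennreal (2 * (V ^ Suc k + \<tau> * (11 * (real (Suc k))\<^sup>2 * 5 ^ Suc k * H ^ (k + 3)) * V ^ k))"
        by (intro ennreal_leI symmetrized_power_le V H \<tau> \<alpha> \<beta>0 \<beta> pos)
      also have "\<tau> * (11 * (real (Suc k))\<^sup>2 * 5 ^ Suc k * H ^ (k + 3)) * V ^ k = (\<tau> * c * V ^ k) * ?Z \<xi> ^ (k + 3)"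
        unfolding H_def c_def power_mult_distrib by (simp only: mult_ac)
      finally show ?thesis
        using V Z c \<tau> by (simp add: ennreal_mult' ennreal_mult'' ennreal_plus del: power_Suc)
    qed
    \<comment> \<open>Reflection invariance replaces twice the integral by the integral of the
      symmetrised function.\<close>
    have "2 * (\<integral>\<^sup>+\<xi>. h \<xi> \<partial>gaussian_measure \<tau>) = (\<integral>\<^sup>+\<xi>. h \<xi> + h (- \<xi>) \<partial>gaussian_measure \<tau>)"
      by (subst nn_integral_add) (auto simp: nn_integral_gaussian_measure_uminus mult_2)
    also have "\<dots> \<le> (\<integral>\<^sup>+\<xi>. 2 * (ennreal (V ^ Suc k) + ennreal (\<tau> * c * V ^ k) * ennreal (?Z \<xi> ^ (k + 3))) \<partial>gaussian_measure \<tau>)"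
      by (intro nn_integral_mono pw)
    also have "\<dots> = 2 * (ennreal (V ^ Suc k) * emeasure (gaussian_measure \<tau> :: (real^'n) measure) UNIV
        + ennreal (\<tau> * c * V ^ k) * (\<integral>\<^sup>+\<xi>. ennreal (?Z \<xi> ^ (k + 3)) \<partial>gaussian_measure \<tau>))"
      by (simp add: nn_integral_cmult nn_integral_add distrib_left mult.assoc del: power_Suc)
    also have "\<dots> \<le> 2 * (ennreal (V ^ Suc k) * 1 + ennreal (\<tau> * c * V ^ k) * ennreal I)"
      unfolding I_def using \<tau>
      by (intro mult_left_mono add_mono emeasure_gaussian_measure_UNIV_le gaussian_measure_one_plus_norm_power_le) auto
    also have "\<dots> = 2 * ennreal (V ^ Suc k + \<tau> * (c * I) * V ^ k)"
      using V c I \<tau> by (simp add: ennreal_mult'[symmetric] ennreal_plus[symmetric] mult_ac del: ennreal_plus power_Suc)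
    finally show "(\<integral>\<^sup>+\<xi>. ennreal ((1 + (norm (u + A *v \<xi>))\<^sup>2 + \<tau> * B) ^ Suc k) \<partial>gaussian_measure \<tau>)
       \<le> ennreal ((1 + (norm u)\<^sup>2) ^ Suc k + \<tau> * (c * I) * (1 + (norm u)\<^sup>2) ^ k)"
      unfolding h_def[symmetric] V_def[symmetric] by (subst (asm) ennreal_mult_le_mult_iff) auto
  qed
qed

section \<open>Independence of the state and the next increment\<close>

text \<open>The state at time n depends only on the noise at times before n, hence is independent of
  the noise at time n. Their joint law is therefore a product and Tonelli gives the iterated
  integral.\<close>

lemma (in prob_space) random_recursion_measurable_and_independent:
  fixes \<xi> :: "nat \<Rightarrow> 'a \<Rightarrow> 'b::{second_countable_topology, t2_space}"
    and X :: "nat \<Rightarrow> 'a \<Rightarrow> 'c::{second_countable_topology, t2_space}"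
  assumes indep: "indep_vars (\<lambda>_. borel) \<xi> {..<Suc n}"
    and g[measurable]: "g \<in> borel \<Otimes>\<^sub>M borel \<rightarrow>\<^sub>M borel"
    and X0: "\<And>\<omega>. \<omega> \<in> space M \<Longrightarrow> X 0 \<omega> = x"
    and XS: "\<And>n \<omega>. \<omega> \<in> space M \<Longrightarrow> X (Suc n) \<omega> = g (X n \<omega>, \<xi> n \<omega>)"
  shows "X n \<in> borel_measurable M"
    and "f \<in> borel_measurable (borel \<Otimes>\<^sub>M borel) \<Longrightarrow>
      (\<integral>\<^sup>+\<omega>. f (X n \<omega>, \<xi> n \<omega>) \<partial>M) = (\<integral>\<^sup>+\<omega>. (\<integral>\<^sup>+z. f (X n \<omega>, z) \<partial>distr M borel (\<xi> n)) \<partial>M)"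
proof -
  \<comment> \<open>\<open>F\<close> unrolls the recursion as a deterministic map on noise
    sequences; \<open>F k\<close> reads only the entries below k, so restricting to indices below n
    changes nothing when k <= n.\<close>
  define F where "F = rec_nat (\<lambda>y. x) (\<lambda>n Fn y. g (Fn y, y n))"
  have F0: "F 0 = (\<lambda>y. x)" and FS: "F (Suc k) = (\<lambda>y. g (F k y, y k))" for k
    by (simp_all add: F_def)
  have Fm: "F k \<in> PiM {..<n} (\<lambda>_. borel) \<rightarrow>\<^sub>M borel" if "k \<le> n" for k
    using that
  proof (induction k)
    case (Suc k)
    then have [measurable]: "F k \<in> PiM {..<n} (\<lambda>_. borel) \<rightarrow>\<^sub>M borel"
      "(\<lambda>y. y k) \<in> PiM {..<n} (\<lambda>_. borel) \<rightarrow>\<^sub>M borel"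
      by (auto intro: measurable_component_singleton)
    show ?case unfolding FS by measurable
  qed (simp add: F0)
  have "X k \<omega> = F k (restrict (\<lambda>i. \<xi> i \<omega>) {..<n})" if "k \<le> n" "\<omega> \<in> space M" for k \<omega>
    using that by (induction k) (auto simp: X0 XS F0 FS)
  then have XF: "X n \<omega> = F n (restrict (\<lambda>i. \<xi> i \<omega>) {..<n})" if "\<omega> \<in> space M" for \<omega>
    using that by simp
  let ?S = "PiM {..<n} (\<lambda>_. borel) :: (nat \<Rightarrow> 'b) measure"
  let ?T = "PiM {n} (\<lambda>_. borel) :: (nat \<Rightarrow> 'b) measure"
  define Y where "Y \<omega> = restrict (\<lambda>i. \<xi> i \<omega>) {..<n}" for \<omega>
  define Z where "Z \<omega> = restrict (\<lambda>i. \<xi> i \<omega>) {n}" for \<omega>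
  \<comment> \<open>The index sets of past and present noise are disjoint.\<close>
  have "indep_var ?S Y ?T Z"
    unfolding Y_def Z_def by (rule indep_var_restrict[OF indep]) auto
  then have Y[measurable]: "Y \<in> M \<rightarrow>\<^sub>M ?S" and Z[measurable]: "Z \<in> M \<rightarrow>\<^sub>M ?T"
    and dist: "distr M ?S Y \<Otimes>\<^sub>M distr M ?T Z = distr M (?S \<Otimes>\<^sub>M ?T) (\<lambda>\<omega>. (Y \<omega>, Z \<omega>))"
    unfolding indep_var_distribution_eq by auto
  have [measurable]: "F n \<in> ?S \<rightarrow>\<^sub>M borel" "(\<lambda>z. z n) \<in> ?T \<rightarrow>\<^sub>M borel"
    using Fm by (auto intro: measurable_component_singleton)
  have XY: "X n \<omega> = F n (Y \<omega>)" if "\<omega> \<in> space M" for \<omega>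
    using XF that by (simp add: Y_def)
  have \<xi>Z: "\<xi> n = (\<lambda>\<omega>. Z \<omega> n)"
    by (simp add: Z_def)
  show "X n \<in> borel_measurable M"
    by (subst measurable_cong[OF XY]) auto
  assume f[measurable]: "f \<in> borel_measurable (borel \<Otimes>\<^sub>M borel)"
  interpret N: prob_space "distr M ?T Z" by (rule prob_space_distr) measurable
  have "(\<integral>\<^sup>+\<omega>. f (X n \<omega>, \<xi> n \<omega>) \<partial>M) = (\<integral>\<^sup>+\<omega>. f (F n (Y \<omega>), Z \<omega> n) \<partial>M)"
    by (intro nn_integral_cong) (simp add: XY \<xi>Z)
  also have "\<dots> = (\<integral>\<^sup>+p. f (F n (fst p), snd p n) \<partial>distr M (?S \<Otimes>\<^sub>M ?T) (\<lambda>\<omega>. (Y \<omega>, Z \<omega>)))"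
    by (subst nn_integral_distr) auto
  also have "\<dots> = (\<integral>\<^sup>+y. \<integral>\<^sup>+z. f (F n y, z n) \<partial>distr M ?T Z \<partial>distr M ?S Y)"
    unfolding dist[symmetric] by (subst N.nn_integral_fst[symmetric]) auto
  also have "\<dots> = (\<integral>\<^sup>+\<omega>. \<integral>\<^sup>+z. f (F n (Y \<omega>), z n) \<partial>distr M ?T Z \<partial>M)"
    by (rule nn_integral_distr) measurable
  also have "\<dots> = (\<integral>\<^sup>+\<omega>. \<integral>\<^sup>+z. f (X n \<omega>, z) \<partial>distr M borel (\<xi> n) \<partial>M)"
    by (intro nn_integral_cong) (simp add: XY \<xi>Z nn_integral_distr)
  finally show "(\<integral>\<^sup>+\<omega>. f (X n \<omega>, \<xi> n \<omega>) \<partial>M) = \<dots>" .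
qed

section \<open>Consequences of the assumptions on the drift\<close>

text \<open>Comparing with v = 0 gives -2 c |u|^2 plus a cross term, and Young's inequality spends
  half of this on 2 |u| |b(0)|. The square \<tau>^2 |b(u)|^2 has a favourable sign and is dropped.
  The summand \<tau> c on the right matches c \<tau> times the 1 on the left.\<close>

lemma strongly_dissipative_implicit_step_le:
  fixes b :: "'a::real_inner \<Rightarrow> 'a"
  assumes c: "0 < c" and \<tau>: "0 < \<tau>"
    and diss: "\<And>u v. (u - v) \<bullet> (b u - b v) \<le> - c * (norm (u - v))\<^sup>2"
  shows "(1 + c * \<tau>) * (1 + (norm u)\<^sup>2) \<le> 1 + (norm (u - \<tau> *\<^sub>R b u))\<^sup>2 + \<tau> * ((norm (b 0))\<^sup>2 / c + c)"
proof -
  have "2 * (u \<bullet> b 0) \<le> 2 * (norm u * norm (b 0))"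
    using norm_cauchy_schwarz[of u "b 0"] by simp
  also have "\<dots> \<le> c * (norm u)\<^sup>2 + (norm (b 0))\<^sup>2 / c"
  proof -
    have "0 \<le> (c * norm u - norm (b 0))\<^sup>2 / c" using c by simp
    also have "\<dots> = c * (norm u)\<^sup>2 - 2 * (norm u * norm (b 0)) + (norm (b 0))\<^sup>2 / c"
      using c by (simp add: power2_diff power_mult_distrib field_simps power2_eq_square)
    finally show ?thesis by simp
  qed
  finally have "2 * (u \<bullet> b u) \<le> (norm (b 0))\<^sup>2 / c - c * (norm u)\<^sup>2"
    using diss[of u 0] by (simp add: inner_diff_right)
  then have "\<tau> * (2 * (u \<bullet> b u)) \<le> \<tau> * ((norm (b 0))\<^sup>2 / c - c * (norm u)\<^sup>2)"
    using \<tau> by (intro mult_left_mono) auto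
  moreover have "(norm (u - \<tau> *\<^sub>R b u))\<^sup>2 = (norm u)\<^sup>2 - \<tau> * (2 * (u \<bullet> b u)) + \<tau>\<^sup>2 * (norm (b u))\<^sup>2"
    unfolding power2_norm_eq_inner
    by (simp add: inner_diff_left inner_diff_right inner_commute power2_eq_square)
  moreover have "0 \<le> \<tau>\<^sup>2 * (norm (b u))\<^sup>2" by simp
  ultimately have "(norm u)\<^sup>2 - \<tau> * ((norm (b 0))\<^sup>2 / c - c * (norm u)\<^sup>2) \<le> (norm (u - \<tau> *\<^sub>R b u))\<^sup>2"
    by linarith
  then show ?thesis by (simp add: algebra_simps)
qed

text \<open>Pair the difference of the images with u - v: dissipativity bounds the product below by
  |u - v|^2, Cauchy-Schwarz bounds it above.\<close>

lemma dissipative_implicit_step_expanding: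
  fixes b :: "'a::real_inner \<Rightarrow> 'a"
  assumes c: "0 \<le> c" and \<tau>: "0 \<le> \<tau>"
    and diss: "\<And>u v. (u - v) \<bullet> (b u - b v) \<le> - c * (norm (u - v))\<^sup>2"
  shows "norm (u - v) \<le> norm ((u - \<tau> *\<^sub>R b u) - (v - \<tau> *\<^sub>R b v))"
proof (cases "u = v")
  case False
  have "(u - v) \<bullet> (b u - b v) \<le> 0"
    using diss[of u v] c by (smt (verit) mult_nonneg_nonneg zero_le_power2 mult_minus_left)
  then have "(norm (u - v))\<^sup>2 \<le> (norm (u - v))\<^sup>2 - \<tau> * ((u - v) \<bullet> (b u - b v))"
    using \<tau> by (simp add: mult_nonneg_nonpos)
  also have "\<dots> = (u - v) \<bullet> ((u - \<tau> *\<^sub>R b u) - (v - \<tau> *\<^sub>R b v))"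
    by (simp add: power2_norm_eq_inner inner_diff_left inner_diff_right algebra_simps)
  also have "\<dots> \<le> norm (u - v) * norm ((u - \<tau> *\<^sub>R b u) - (v - \<tau> *\<^sub>R b v))"
    by (rule norm_cauchy_schwarz)
  finally show ?thesis using False by (simp add: power2_eq_square)
qed simp

text \<open>On the unit ball around a point the growth weights are bounded, so b satisfies a linear
  bound there.\<close>

lemma continuous_on_polynomial_lipschitz:
  fixes b :: "'a::real_normed_vector \<Rightarrow> 'b::real_normed_vector"
  assumes L: "0 \<le> L" and q: "1 \<le> q"
    and lip: "\<And>u v. norm (b u - b v) \<le> L * (1 + rpow (norm u) (q - 1) + rpow (norm v) (q - 1)) * norm (u - v)"
  shows "continuous_on UNIV b"
proof -
  have "isCont b v" for v
  proof -
    define R where "R = rpow (norm v + 1) (q - 1)"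
    \<comment> \<open>For q = 1 the exponent is 0 and both sides equal 1; otherwise the real power
      is monotone.\<close>
    have mono: "rpow s (q - 1) \<le> R" if "0 \<le> s" "s \<le> norm v + 1" for s
      using that q by (auto simp: R_def rpow_def intro: powr_mono2)
    have bound: "norm (b u - b v) \<le> L * (1 + R + R) * norm (u - v)" if "u \<in> ball v 1" for u
    proof -
      have "norm u \<le> norm v + 1"
        using that norm_triangle_sub[of u v] by (auto simp: dist_norm norm_minus_commute)
      then show ?thesis
        using L by (intro order.trans[OF lip] mult_right_mono mult_left_mono add_mono mono order.refl) auto
    qed
    have lim: "((\<lambda>u. L * (1 + R + R) * norm (u - v)) \<longlongrightarrow> L * (1 + R + R) * norm (v - v)) (at v)"
      by (intro tendsto_intros)
    have "((\<lambda>u. b u - b v) \<longlongrightarrow> 0) (at v)"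
    proof (rule Lim_null_comparison)
      have "\<forall>\<^sub>F u in at v. u \<in> ball v 1" by (intro eventually_at_in_open') auto
      then show "\<forall>\<^sub>F u in at v. norm (b u - b v) \<le> L * (1 + R + R) * norm (u - v)"
        by (rule eventually_mono) (rule bound)
    qed (use lim in simp)
    then show ?thesis by (simp add: isCont_def LIM_zero_iff)
  qed
  then show ?thesis by (simp add: continuous_at_imp_continuous_on)
qed

section \<open>The moment recursion for the scheme\<close>

text \<open>Split at V = K / \<delta>: above it K <= \<delta> V, below it V^k is at most (K /
  \<delta>)^k.\<close>

lemma power_absorb:
  fixes V K \<delta> :: real
  assumes "1 \<le> V" "0 \<le> K" "0 < \<delta>"
  shows "K * V ^ k \<le> \<delta> * V ^ Suc k + K * (K / \<delta>) ^ k"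
proof (cases "K / \<delta> \<le> V")
  case True
  then have "K * V ^ k \<le> (\<delta> * V) * V ^ k"
    using assms by (intro mult_right_mono) (auto simp: field_simps)
  also have "\<dots> \<le> \<dots> + K * (K / \<delta>) ^ k" using assms by simp
  finally show ?thesis by simp
next
  case False
  then have "K * V ^ k \<le> K * (K / \<delta>) ^ k"
    using assms by (intro mult_left_mono power_mono) auto
  moreover have "0 \<le> \<delta> * V ^ Suc k" using assms by simp
  ultimately show ?thesis by linarith
qed

text \<open>Induction on n with the same bound at every step; the maximum covers the initial value
  and the level at which the contraction balances the error.\<close>

lemma backward_euler_even_moment_le:
  fixes b :: "real^'d \<Rightarrow> real^'d" and \<sigma> :: "real^'d \<Rightarrow> real^'D^'d"
    and M :: "'a measure" and W :: "real \<Rightarrow> 'a \<Rightarrow> real^'D"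
  assumes \<sigma>_cont: "continuous_on UNIV \<sigma>" and \<sigma>_le: "\<And>u. norm (\<sigma> u) \<le> L"
    and b_cont: "continuous_on UNIV b" and c: "0 < c"
    and diss: "\<And>u v. (u - v) \<bullet> (b u - b v) \<le> - c * (norm (u - v))\<^sup>2"
    and BM: "std_brownian_motion M W"
  obtains C where "0 \<le> C"
    and "\<And>\<tau> x X n. 0 < \<tau> \<Longrightarrow> \<tau> \<le> 1 \<Longrightarrow> \<forall>\<omega>\<in>space M. X 0 \<omega> = x \<Longrightarrow>
      \<forall>n. \<forall>\<omega>\<in>space M. X (Suc n) \<omega> = X n \<omega> + \<tau> *\<^sub>R b (X (Suc n) \<omega>)
          + \<sigma> (X n \<omega>) *v (W (real (Suc n) * \<tau>) \<omega> - W (real n * \<tau>) \<omega>) \<Longrightarrow>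
      X n \<in> borel_measurable M \<and>
      (\<integral>\<^sup>+\<omega>. ennreal ((1 + (norm (X n \<omega>))\<^sup>2) ^ Suc k) \<partial>M) \<le> ennreal (max ((1 + (norm x)\<^sup>2) ^ Suc k) C)"
proof -
  interpret prob_space M using BM by (simp add: std_brownian_motion_def)
  define B where "B = (norm (b 0))\<^sup>2 / c + c"
  have B: "0 \<le> B" using c by (simp add: B_def)
  obtain K where K: "0 \<le> K" and step: "\<And>\<tau> (u::real^'d) (A::real^'D^'d). 0 < \<tau> \<Longrightarrow> \<tau> \<le> 1 \<Longrightarrow> norm A \<le> L \<Longrightarrow>
     (\<integral>\<^sup>+\<xi>. ennreal ((1 + (norm (u + A *v \<xi>))\<^sup>2 + \<tau> * B) ^ Suc k) \<partial>gaussian_measure \<tau>)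
       \<le> ennreal ((1 + (norm u)\<^sup>2) ^ Suc k + \<tau> * K * (1 + (norm u)\<^sup>2) ^ k)"
    using gaussian_step_moment_le[OF B, of L k, where 'd='d and 'n='D] by blast
  \<comment> \<open>Absorption with \<delta> = c / 2 uses half of the contraction rate c.\<close>
  define E where "E = K * (K / (c / 2)) ^ k"
  have E: "0 \<le> E" using K c by (simp add: E_def)
  show ?thesis
  \<comment> \<open>The remaining half must pay for the error, that is E <= (c / 2) A, which holds
    for A >= 2 E / c.\<close>
  proof (rule that[of "2 * E / c"], goal_cases nonneg bound)
    case nonneg
    show ?case using E c by simp
  next
    case (bound \<tau> x X n)
    note \<tau> = bound(1,2) and X0 = bound(3) and XS = bound(4)
    define \<xi> where "\<xi> n \<omega> = W (real (Suc n) * \<tau>) \<omega> - W (real n * \<tau>) \<omega>" for n \<omega>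
    \<comment> \<open>The explicit part of the step; the implicit part is then undone by
      \<open>g\<close>.\<close>
    define S where "S p = fst p + \<sigma> (fst p) *v snd p" for p
    have "continuous_on UNIV S"
      unfolding S_def matrix_mult_dot
      by (intro continuous_intros continuous_on_compose2[OF \<sigma>_cont]) auto
    then have S[measurable]: "S \<in> borel \<Otimes>\<^sub>M borel \<rightarrow>\<^sub>M borel"
      unfolding borel_prod by (rule borel_measurable_continuous_onI)
    have cont: "continuous_on UNIV (\<lambda>u. u - \<tau> *\<^sub>R b u)"
      by (intro continuous_intros b_cont)
    obtain g where g[measurable]: "g \<in> borel_measurable borel" and g_eq: "\<And>u. g (u - \<tau> *\<^sub>R b u) = u"
      using measurable_left_inverse_expanding[OF cont
          dissipative_implicit_step_expanding[OF less_imp_le[OF c] less_imp_le[OF \<tau>(1)] diss]] by blast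
    have S_eq: "X (Suc n) \<omega> - \<tau> *\<^sub>R b (X (Suc n) \<omega>) = S (X n \<omega>, \<xi> n \<omega>)" if "\<omega> \<in> space M" for n \<omega>
      using XS[rule_format, OF that, of n] unfolding S_def \<xi>_def fst_conv snd_conv
      by (metis (no_types, lifting) add.commute add.left_commute add_diff_cancel_left')
    have X_step: "X (Suc n) \<omega> = (g \<circ> S) (X n \<omega>, \<xi> n \<omega>)" if "\<omega> \<in> space M" for n \<omega>
      using g_eq[of "X (Suc n) \<omega>"] S_eq[OF that] by simp
    have gS: "g \<circ> S \<in> borel \<Otimes>\<^sub>M borel \<rightarrow>\<^sub>M borel" by measurable
    have indep: "indep_vars (\<lambda>_. borel) \<xi> {..<Suc n}" for n
    proof -
      have "\<forall>(n::nat) (tt::nat \<Rightarrow> real). 0 \<le> tt 0 \<and> (\<forall>i<n. tt i < tt (Suc i)) \<longrightarrow>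
          indep_vars (\<lambda>_. borel) (\<lambda>i \<omega>. W (tt (Suc i)) \<omega> - W (tt i) \<omega>) {..<n}"
        using BM unfolding std_brownian_motion_def by (elim conjE)
      \<comment> \<open>Sampling at the grid points i \<tau>; these are increasing because \<tau> >
        0.\<close>
      from this[THEN spec[of _ "Suc n"], THEN spec[of _ "\<lambda>i. real i * \<tau>"]] show ?thesis
        using \<tau> by (simp add: \<xi>_def[abs_def])
    qed
    have law: "distr M borel (\<xi> n) = gaussian_measure \<tau>" for n
    proof -
      have "distributed M lborel (\<xi> n)
          (\<lambda>v. ennreal (\<Prod>j\<in>UNIV. normal_density 0 (sqrt (real (Suc n) * \<tau> - real n * \<tau>)) (v $ j)))"
        using BM \<tau> unfolding std_brownian_motion_def \<xi>_def by simp
      moreover have "real (Suc n) * \<tau> - real n * \<tau> = \<tau>" by (simp add: algebra_simps)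
      ultimately have "distr M lborel (\<xi> n) = gaussian_measure \<tau>"
        unfolding gaussian_measure_def distributed_def by simp
      moreover have "distr M lborel (\<xi> n) = distr M borel (\<xi> n)" by (rule distr_cong) auto
      ultimately show ?thesis by simp
    qed
    note rr = random_recursion_measurable_and_independent[of \<xi> _ "g \<circ> S" X x, OF indep gS X0[rule_format] X_step]
    have Xm[measurable]: "X n \<in> borel_measurable M" for n
      by (rule rr(1))
    define A where "A = max ((1 + (norm x)\<^sup>2) ^ Suc k) (2 * E / c)"
    have A0: "0 \<le> A" using E c by (simp add: A_def le_max_iff_disj)
    have EA: "E \<le> c / 2 * A"
    proof -
      have "2 * E / c \<le> A" by (simp add: A_def)
      then show ?thesis using c by (simp add: field_simps)
    qed
    let ?V = "\<lambda>n \<omega>. 1 + (norm (X n \<omega>))\<^sup>2"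
    have "(\<integral>\<^sup>+\<omega>. ennreal (?V n \<omega> ^ Suc k) \<partial>M) \<le> ennreal A" for n
    proof (induction n)
      case 0
      have "(\<integral>\<^sup>+\<omega>. ennreal (?V 0 \<omega> ^ Suc k) \<partial>M) = (\<integral>\<^sup>+\<omega>. ennreal ((1 + (norm x)\<^sup>2) ^ Suc k) \<partial>M)"
        using X0 by (intro nn_integral_cong) auto
      then show ?case
        by (simp add: emeasure_space_1 A_def ennreal_leI del: power_Suc)
    next
      case (Suc n)
      let ?a = "1 + c * \<tau>"
      let ?h = "\<lambda>p. ennreal ((1 + (norm (S p))\<^sup>2 + \<tau> * B) ^ Suc k)"
      have a: "1 \<le> ?a" using c \<tau> by simp
      have "ennreal ?a * (\<integral>\<^sup>+\<omega>. ennreal (?V (Suc n) \<omega> ^ Suc k) \<partial>M)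
          = (\<integral>\<^sup>+\<omega>. ennreal (?a * ?V (Suc n) \<omega> ^ Suc k) \<partial>M)"
        using a by (subst nn_integral_cmult[symmetric]) (auto simp: ennreal_mult' simp del: power_Suc)
      also have "\<dots> \<le> (\<integral>\<^sup>+\<omega>. ?h (X n \<omega>, \<xi> n \<omega>) \<partial>M)"
      proof (intro nn_integral_mono ennreal_leI)
        fix \<omega> assume \<omega>: "\<omega> \<in> space M"
        \<comment> \<open>As \<open>?a\<close> is at least 1, one factor of its power is kept and
          the others are discarded.\<close>
        have "?a * ?V (Suc n) \<omega> ^ Suc k \<le> ?a ^ Suc k * ?V (Suc n) \<omega> ^ Suc k"
          using a by (intro mult_right_mono self_le_power) auto
        also have "\<dots> = (?a * ?V (Suc n) \<omega>) ^ Suc k" by (rule power_mult_distrib[symmetric])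
        also have "\<dots> \<le> (1 + (norm (S (X n \<omega>, \<xi> n \<omega>)))\<^sup>2 + \<tau> * B) ^ Suc k"
          using a strongly_dissipative_implicit_step_le[OF c \<tau>(1) diss, of "X (Suc n) \<omega>"]
          unfolding S_eq[OF \<omega>] B_def[symmetric] by (intro power_mono) auto
        finally show "?a * ?V (Suc n) \<omega> ^ Suc k \<le> (1 + (norm (S (X n \<omega>, \<xi> n \<omega>)))\<^sup>2 + \<tau> * B) ^ Suc k" .
      qed
      also have "\<dots> = (\<integral>\<^sup>+\<omega>. \<integral>\<^sup>+z. ?h (X n \<omega>, z) \<partial>gaussian_measure \<tau> \<partial>M)"
        unfolding law[symmetric, of n] by (rule rr(2)) measurable
      also have "\<dots> \<le> (\<integral>\<^sup>+\<omega>. ennreal (1 + c / 2 * \<tau>) * ennreal (?V n \<omega> ^ Suc k) + ennreal (\<tau> * E) \<partial>M)"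
      proof (rule nn_integral_mono)
        fix \<omega>
        \<comment> \<open>The state is frozen: u is \<open>X n \<omega>\<close> and A is \<sigma> at
          u. The uniform bound on \<sigma> makes \<open>K\<close> independent of the state.\<close>
        have "(\<integral>\<^sup>+z. ?h (X n \<omega>, z) \<partial>gaussian_measure \<tau>)
            \<le> ennreal (?V n \<omega> ^ Suc k + \<tau> * K * ?V n \<omega> ^ k)"
          unfolding S_def fst_conv snd_conv by (rule step[OF \<tau> \<sigma>_le])
        also have "\<dots> \<le> ennreal ((1 + c / 2 * \<tau>) * ?V n \<omega> ^ Suc k + \<tau> * E)"
        proof (rule ennreal_leI)
          have "K * ?V n \<omega> ^ k \<le> c / 2 * ?V n \<omega> ^ Suc k + E"
            unfolding E_def using K c by (intro power_absorb) auto
          then have "\<tau> * (K * ?V n \<omega> ^ k) \<le> \<tau> * (c / 2 * ?V n \<omega> ^ Suc k + E)"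
            using \<tau> by (intro mult_left_mono) auto
          then show "?V n \<omega> ^ Suc k + \<tau> * K * ?V n \<omega> ^ k \<le> (1 + c / 2 * \<tau>) * ?V n \<omega> ^ Suc k + \<tau> * E"
            by (simp only: ring_distribs mult_ac mult_1_left)
        qed
        also have "\<dots> = ennreal (1 + c / 2 * \<tau>) * ennreal (?V n \<omega> ^ Suc k) + ennreal (\<tau> * E)"
          using c \<tau> E by (simp add: ennreal_mult' ennreal_plus del: power_Suc)
        finally show "(\<integral>\<^sup>+z. ?h (X n \<omega>, z) \<partial>gaussian_measure \<tau>)
            \<le> ennreal (1 + c / 2 * \<tau>) * ennreal (?V n \<omega> ^ Suc k) + ennreal (\<tau> * E)" .
      qed
      also have "\<dots> = ennreal (1 + c / 2 * \<tau>) * (\<integral>\<^sup>+\<omega>. ennreal (?V n \<omega> ^ Suc k) \<partial>M) + ennreal (\<tau> * E)"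
        by (simp add: nn_integral_add nn_integral_cmult emeasure_space_1 del: power_Suc)
      also have "\<dots> \<le> ennreal (1 + c / 2 * \<tau>) * ennreal A + ennreal (\<tau> * E)"
        by (intro add_mono mult_left_mono Suc) auto
      also have "\<dots> = ennreal ((1 + c / 2 * \<tau>) * A + \<tau> * E)"
        using c \<tau> E A0 by (simp add: ennreal_mult' ennreal_plus)
      also have "\<dots> \<le> ennreal (?a * A)"
      proof (rule ennreal_leI)
        have "\<tau> * E \<le> \<tau> * (c / 2 * A)" using EA \<tau> by (intro mult_left_mono) auto
        then have "(1 + c / 2 * \<tau>) * A + \<tau> * E \<le> (1 + c / 2 * \<tau>) * A + \<tau> * (c / 2 * A)" by simp
        also have "\<dots> = ?a * A" by (simp add: algebra_simps)
        finally show "(1 + c / 2 * \<tau>) * A + \<tau> * E \<le> ?a * A" .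
      qed
      also have "\<dots> = ennreal ?a * ennreal A"
        using a by (simp add: ennreal_mult')
      finally show ?case
        using a by (subst (asm) ennreal_mult_le_mult_iff) auto
    qed
    then show ?case
      unfolding A_def using Xm by blast
  qed
qed

section \<open>From even moments to moments of order r\<close>

text \<open>For t > l the exponent r - 2 m <= 0 lets l replace t in t^(r - 2 m). With l of the size
  of the initial value, a bound by l^(2 m) on the even moment becomes one by l^r.\<close>

lemma powr_le_scaled_even_power:
  fixes t l r :: real
  assumes t: "0 \<le> t" and l: "1 \<le> l" and r: "0 \<le> r" "r \<le> 2 * real m"
  shows "t powr r \<le> l powr (r - 2 * real m) * (1 + t\<^sup>2) ^ m + l powr r"
proof (cases "t \<le> l")
  case True
  then have "t powr r \<le> l powr r" using t r by (intro powr_mono2) auto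
  also have "\<dots> \<le> l powr (r - 2 * real m) * (1 + t\<^sup>2) ^ m + l powr r" by simp
  finally show ?thesis .
next
  case False
  have "t powr r = t powr (r - 2 * real m) * t powr (2 * real m)"
    by (simp add: powr_add[symmetric])
  also have "t powr (2 * real m) = (t\<^sup>2) ^ m"
    using False l powr_realpow[of t "2 * m"] by (simp add: power_mult)
  also have "t powr (r - 2 * real m) * (t\<^sup>2) ^ m \<le> l powr (r - 2 * real m) * (1 + t\<^sup>2) ^ m"
    using False l r by (intro mult_mono powr_mono2' power_mono) auto
  also have "\<dots> \<le> \<dots> + l powr r" by simp
  finally show ?thesis .
qed

theorem theorem4p1:
  fixes b :: "real^'d \<Rightarrow> real^'d" and \<sigma> :: "real^'d \<Rightarrow> real^'D^'d"
    and M :: "'a measure" and W :: "real \<Rightarrow> 'a \<Rightarrow> real^'D"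
    and L1 L2 L3 c1 q r :: real
  assumes A1a: "L1 > 0" and A1b: "L2 > 0"
    and A1c: "\<forall>u1 u2. hs_norm (\<sigma> u1 - \<sigma> u2) \<le> L1 * norm (u1 - u2)"
    and A1d: "\<forall>u. hs_norm (\<sigma> u) \<le> L2"
    and A2a: "c1 > 15/2 * L1^2" and A2b: "L3 > 0" and A2c: "q \<ge> 1"
    and A2d: "\<forall>u1 u2. inner (u1 - u2) (b u1 - b u2) \<le> - c1 * (norm (u1 - u2))^2"
    and A2e: "\<forall>u1 u2. norm (b u1 - b u2)
                \<le> L3 * (1 + rpow (norm u1) (q - 1) + rpow (norm u2) (q - 1)) * norm (u1 - u2)"
    and BM: "std_brownian_motion M W"
    and r: "r \<ge> 1"
  shows "\<exists>K>0. \<forall>(\<tau>::real) (x::real^'d) (X::nat \<Rightarrow> 'a \<Rightarrow> real^'d).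
           0 < \<tau> \<longrightarrow> \<tau> \<le> 1 \<longrightarrow>
           (\<forall>\<omega>\<in>space M. X 0 \<omega> = x) \<longrightarrow>
           (\<forall>n. \<forall>\<omega>\<in>space M. X (Suc n) \<omega> =
               X n \<omega> + \<tau> *\<^sub>R b (X (Suc n) \<omega>)
               + \<sigma> (X n \<omega>) *v (W (real (Suc n) * \<tau>) \<omega> - W (real n * \<tau>) \<omega>)) \<longrightarrow>
           (\<forall>n. (\<integral>\<^sup>+\<omega>. ennreal (norm (X n \<omega>) powr r) \<partial>M)
                  \<le> ennreal (K * (1 + norm x powr r)))"
proof -
  interpret prob_space M using BM by (simp add: std_brownian_motion_def)
  have c: "0 < c1"
    using A2a zero_le_power2[of L1] by linarith
  have \<sigma>_cont: "continuous_on UNIV \<sigma>"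
    using A1a A1c by (intro lipschitz_on_continuous_on[where L=L1] lipschitz_onI) (auto simp: dist_norm hs_norm_eq_norm)
  have b_cont: "continuous_on UNIV b"
    using A2b A2c A2e by (intro continuous_on_polynomial_lipschitz[of L3 q]) auto
  have \<sigma>_le: "\<And>u. norm (\<sigma> u) \<le> L2"
    using A1d by (simp add: hs_norm_eq_norm)
  obtain k where k: "r \<le> 2 * real (Suc k)"
  proof -
    obtain k where "r \<le> real k" using real_arch_simple by blast
    then show thesis by (intro that[of k]) simp
  qed
  obtain C where C: "0 \<le> C"
    and moment: "\<And>\<tau> x X n. 0 < \<tau> \<Longrightarrow> \<tau> \<le> 1 \<Longrightarrow> \<forall>\<omega>\<in>space M. X 0 \<omega> = x \<Longrightarrow>
      \<forall>n. \<forall>\<omega>\<in>space M. X (Suc n) \<omega> = X n \<omega> + \<tau> *\<^sub>R b (X (Suc n) \<omega>)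
          + \<sigma> (X n \<omega>) *v (W (real (Suc n) * \<tau>) \<omega> - W (real n * \<tau>) \<omega>) \<Longrightarrow>
      X n \<in> borel_measurable M \<and>
      (\<integral>\<^sup>+\<omega>. ennreal ((1 + (norm (X n \<omega>))\<^sup>2) ^ Suc k) \<partial>M) \<le> ennreal (max ((1 + (norm x)\<^sup>2) ^ Suc k) C)"
    by (rule backward_euler_even_moment_le[where k=k, OF \<sigma>_cont \<sigma>_le b_cont c A2d[rule_format] BM]) (rule that)
  show ?thesis
  \<comment> \<open>The interpolation yields (1 + C) l^r + l^r, and 2^r comes from l <= 2 max(1,
    |x|).\<close>
  proof (intro exI[of _ "(2 + C) * 2 powr r"] conjI allI impI)
    show "0 < (2 + C) * 2 powr r" using C by simp
    fix \<tau> :: real and x and X :: "nat \<Rightarrow> 'a \<Rightarrow> real^'d" and n :: nat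
    assume "0 < \<tau>" "\<tau> \<le> 1" "\<forall>\<omega>\<in>space M. X 0 \<omega> = x"
      "\<forall>n. \<forall>\<omega>\<in>space M. X (Suc n) \<omega> = X n \<omega> + \<tau> *\<^sub>R b (X (Suc n) \<omega>)
          + \<sigma> (X n \<omega>) *v (W (real (Suc n) * \<tau>) \<omega> - W (real n * \<tau>) \<omega>)"
    note mom = moment[OF this, of n]
    have [measurable]: "X n \<in> borel_measurable M" using mom by simp
    define l where "l = 1 + norm x"
    define p where "p = r - 2 * real (Suc k)"
    have l: "1 \<le> l" by (simp add: l_def)
    have l2: "l powr (2 * real (Suc k)) = (l\<^sup>2) ^ Suc k"
      using l powr_realpow[of l "2 * Suc k"] unfolding of_nat_mult of_nat_numeral power_mult by simp
    have "(\<integral>\<^sup>+\<omega>. ennreal (norm (X n \<omega>) powr r) \<partial>M)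
        \<le> (\<integral>\<^sup>+\<omega>. ennreal (l powr p) * ennreal ((1 + (norm (X n \<omega>))\<^sup>2) ^ Suc k) + ennreal (l powr r) \<partial>M)"
      using powr_le_scaled_even_power[OF norm_ge_zero l _ k] r
      by (intro nn_integral_mono)
         (auto simp: p_def ennreal_mult'[symmetric] ennreal_plus[symmetric] ennreal_leI simp del: ennreal_plus power_Suc)
    also have "\<dots> = ennreal (l powr p) * (\<integral>\<^sup>+\<omega>. ennreal ((1 + (norm (X n \<omega>))\<^sup>2) ^ Suc k) \<partial>M) + ennreal (l powr r)"
      by (simp add: nn_integral_add nn_integral_cmult emeasure_space_1 del: power_Suc)
    also have "\<dots> \<le> ennreal (l powr p) * ennreal (max ((1 + (norm x)\<^sup>2) ^ Suc k) C) + ennreal (l powr r)"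
      using mom by (intro add_mono mult_left_mono) auto
    also have "\<dots> = ennreal (l powr p * max ((1 + (norm x)\<^sup>2) ^ Suc k) C + l powr r)"
      using C by (simp add: ennreal_mult' ennreal_plus le_max_iff_disj del: power_Suc)
    also have "\<dots> \<le> ennreal ((2 + C) * 2 powr r * (1 + norm x powr r))"
    proof (rule ennreal_leI)
      have one: "1 \<le> (l\<^sup>2) ^ Suc k" using l by (intro one_le_power) auto
      \<comment> \<open>Both entries of the maximum are dominated by multiples of l^(2 Suc k), by 1
        + |x|^2 <= l^2 and l >= 1.\<close>
      have "(1 + (norm x)\<^sup>2) ^ Suc k \<le> (l\<^sup>2) ^ Suc k"
        by (intro power_mono) (auto simp: l_def power2_eq_square algebra_simps)
      moreover have "C * 1 \<le> C * (l\<^sup>2) ^ Suc k"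
        using C one by (intro mult_left_mono)
      ultimately have "max ((1 + (norm x)\<^sup>2) ^ Suc k) C \<le> (1 + C) * (l\<^sup>2) ^ Suc k"
        using C one unfolding distrib_right by (intro max.boundedI) linarith+
      then have "l powr p * max ((1 + (norm x)\<^sup>2) ^ Suc k) C + l powr r
          \<le> l powr p * ((1 + C) * (l\<^sup>2) ^ Suc k) + l powr r"
        by (intro add_right_mono mult_left_mono) auto
      also have "\<dots> = (1 + C) * (l powr p * l powr (2 * real (Suc k))) + l powr r"
        unfolding l2 by (simp only: mult_ac)
      also have "\<dots> = (2 + C) * l powr r"
        unfolding powr_add[symmetric] p_def by (simp add: algebra_simps)
      also have "(2 + C) * l powr r \<le> (2 + C) * (2 powr r * (1 + norm x powr r))"
      proof -
        have "l powr r \<le> (2 * max 1 (norm x)) powr r"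
          using r by (intro powr_mono2) (auto simp: l_def)
        also have "\<dots> = 2 powr r * max 1 (norm x) powr r" by (simp add: powr_mult)
        also have "max 1 (norm x) powr r \<le> 1 + norm x powr r" by (simp add: max_def)
        finally have "l powr r \<le> 2 powr r * (1 + norm x powr r)" by simp
        then show ?thesis using C by (intro mult_left_mono) auto
      qed
      finally show "l powr p * max ((1 + (norm x)\<^sup>2) ^ Suc k) C + l powr r \<le> (2 + C) * 2 powr r * (1 + norm x powr r)"
        by (simp only: mult.assoc)
    qed
    finally show "(\<integral>\<^sup>+\<omega>. ennreal (norm (X n \<omega>) powr r) \<partial>M) \<le> ennreal ((2 + C) * 2 powr r * (1 + norm x powr r))" .
  qed
qed

end
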